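(* Let $G$ be a connected graph and let $m\in\mathbb{N}$ with $m>1$. (a) If $m$ is even and $\Delta(G)\geq 4$, then $\chi(G^{\frac{m}{n}})=\omega(G^{\frac{m}{n}})$ for every integer $n\geq 2m+2$. (b) If $m$ is odd and $\Delta(G)\geq 5$, then $\chi(G^{\frac{m}{n}})=\omega(G^{\frac{m}{n}})$ for every integer $n\geq 2m+2$.
   Context: All graphs are finite and simple; $\Delta$ is the maximum degree, $\chi$ the chromatic number, $\omega$ the clique number. For a graph $H$ and $m\in\mathbb{N}$, the $m$-power $H^m$ has vertex set $V(H)$, with distinct vertices $x,y$ adjacent iff $1\le d_H(x,y)\le m$. For $n\in\mathbb{N}$, the $n$-subdivision $G^{\frac1n}$ is obtained from $G$ by replacing each edge by a path of length $n$. The fractional power $G^{\frac{m}{n}}$ is $(G^{\frac1n})^m$. *)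

theory Defs
  imports
    "Graph_Theory.Digraph_Component"
    "Graph_Theory.Pair_Digraph"
    "Graph_Theory.Shortest_Path"
    "HOL-Library.Multiset"
begin

text \<open>
  A finite simple graph is a \<^locale>\<open>pair_graph\<close>: a finite, loop-free, symmetric digraph in
  which an undirected edge \<open>uv\<close> is the pair of arcs \<open>(u, v)\<close> and \<open>(v, u)\<close>.  The degree of a
  vertex is therefore its out-degree.
\<close>

definition max_degree :: "'a pair_pre_digraph \<Rightarrow> nat" where
  "max_degree G = Max (out_degree (with_proj G) ` pverts G)"

definition proper_coloring :: "'a pair_pre_digraph \<Rightarrow> ('a \<Rightarrow> 'c) \<Rightarrow> bool" where
  "proper_coloring G c \<longleftrightarrow> (\<forall>(u, v) \<in> parcs G. c u \<noteq> c v)"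

definition chromatic_number :: "'a pair_pre_digraph \<Rightarrow> nat" where
  "chromatic_number G =
     (LEAST k. \<exists>c :: 'a \<Rightarrow> nat. c ` pverts G \<subseteq> {..<k} \<and> proper_coloring G c)"

definition clique :: "'a pair_pre_digraph \<Rightarrow> 'a set \<Rightarrow> bool" where
  "clique G C \<longleftrightarrow> C \<subseteq> pverts G \<and> (\<forall>u \<in> C. \<forall>v \<in> C. u \<noteq> v \<longrightarrow> (u, v) \<in> parcs G)"

definition clique_number :: "'a pair_pre_digraph \<Rightarrow> nat" where
  "clique_number G = Max {card C | C. clique G C}"

text \<open>The distance is \<open>\<infinity>\<close> between vertices of different components.\<close>

definition graph_dist :: "'a pair_pre_digraph \<Rightarrow> 'a \<Rightarrow> 'a \<Rightarrow> ereal" where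
  "graph_dist G u v = wf_digraph.\<mu> (with_proj G) (\<lambda>_. 1) u v"

definition graph_power :: "'a pair_pre_digraph \<Rightarrow> nat \<Rightarrow> 'a pair_pre_digraph" where
  "graph_power H m = \<lparr>
     pverts = pverts H,
     parcs = {(x, y). x \<in> pverts H \<and> y \<in> pverts H \<and> x \<noteq> y \<and>
                1 \<le> graph_dist H x y \<and> graph_dist H x y \<le> ereal (real m)}\<rparr>"

text \<open>
  The vertices of the \<open>n\<close>-subdivision are multisets of size \<open>n\<close> over the vertices of \<open>G\<close>.  The
  \<open>i\<close>-th vertex on the path of length \<open>n\<close> that replaces the edge \<open>uv\<close>, counted from \<open>u\<close>,
  consists of \<open>n - i\<close> copies of \<open>u\<close> and \<open>i\<close> copies of \<open>v\<close>; counted from \<open>v\<close> it is the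
  \<open>(n - i)\<close>-th one and is given by the same multiset, so both arcs of an edge describe the same
  path.  The path ends, \<open>i = 0\<close> and \<open>i = n\<close>, are \<open>n\<close> copies of \<open>u\<close> and of \<open>v\<close>, which stand for
  the original vertices \<open>u\<close> and \<open>v\<close>; paths of distinct edges share no other vertices.
  This describes the subdivision for \<open>n > 0\<close>; the value at \<open>n = 0\<close> has no meaning.
\<close>

definition sd_vertex :: "nat \<Rightarrow> 'a \<Rightarrow> 'a \<Rightarrow> nat \<Rightarrow> 'a multiset" where
  "sd_vertex n u v i = replicate_mset (n - i) u + replicate_mset i v"

definition n_subdivision :: "'a pair_pre_digraph \<Rightarrow> nat \<Rightarrow> 'a multiset pair_pre_digraph" where
  "n_subdivision G n = \<lparr>
     pverts = replicate_mset n ` pverts G \<union>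
       {sd_vertex n u v i | u v i. (u, v) \<in> parcs G \<and> 0 < i \<and> i < n},
     parcs =
       {(sd_vertex n u v i, sd_vertex n u v (i + 1)) | u v i. (u, v) \<in> parcs G \<and> i < n} \<union>
       {(sd_vertex n u v (i + 1), sd_vertex n u v i) | u v i. (u, v) \<in> parcs G \<and> i < n}\<rparr>"

definition fractional_power ::
  "'a pair_pre_digraph \<Rightarrow> nat \<Rightarrow> nat \<Rightarrow> 'a multiset pair_pre_digraph" where
  "fractional_power G m n = graph_power (n_subdivision G n) m"

lemma graph_dist_le_iff:
  assumes "pair_graph G"
  shows "graph_dist G u v \<le> ereal (real k) \<longleftrightarrow>
    (\<exists>p. pre_digraph.awalk (with_proj G) u p v \<and> length p \<le> k)"
proof -
  interpret pair_graph G by fact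
  have cost: "awalk_cost (\<lambda>_. 1) p = real (length p)" for p :: "('a \<times> 'a) list"
    by (induct p) simp_all
  show ?thesis
  proof
    assume le: "graph_dist G u v \<le> ereal (real k)"
    show "\<exists>p. awalk u p v \<and> length p \<le> k"
    proof (rule ccontr)
      assume "\<not> (\<exists>p. awalk u p v \<and> length p \<le> k)"
      then have "ereal (real k + 1) \<le> graph_dist G u v"
        unfolding graph_dist_def \<mu>_def by (intro INF_greatest) (force simp: cost)
      from this le have "ereal (real k + 1) \<le> ereal (real k)"
        by (rule order_trans)
      then show False by simp
    qed
  next
    assume "\<exists>p. awalk u p v \<and> length p \<le> k"
    then obtain p where p: "awalk u p v" "length p \<le> k" by blast
    have "graph_dist G u v \<le> ereal (awalk_cost (\<lambda>_. 1) p)"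
      unfolding graph_dist_def by (rule min_cost_le_walk_cost) (rule p)
    also have "\<dots> \<le> ereal (real k)" using p by (simp add: cost)
    finally show "graph_dist G u v \<le> ereal (real k)" .
  qed
qed

lemma graph_dist_commute:
  assumes "pair_graph G"
  shows "graph_dist G u v = graph_dist G v u"
proof -
  interpret pair_graph G by fact
  have cost: "awalk_cost (\<lambda>_. 1) p = real (length p)" for p :: "('a \<times> 'a) list"
    by (induct p) simp_all
  have len: "length (rev_path p) = length p" for p :: "('a \<times> 'a) list"
    by (induct p) simp_all
  have "graph_dist G x y \<le> graph_dist G y x" for x y
    unfolding graph_dist_def \<mu>_def
  proof (rule INF_greatest)
    fix p assume "p \<in> {p. awalk y p x}"
    then have "rev_path p \<in> {p. awalk x p y}" by simp
    then show "(INF p\<in>{p. awalk x p y}. ereal (awalk_cost (\<lambda>_. 1) p))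
        \<le> ereal (awalk_cost (\<lambda>_. 1) p)"
      by (rule INF_lower2) (simp add: cost len)
  qed
  then show ?thesis by (intro antisym)
qed

lemma pair_graph_power:
  assumes "pair_graph H"
  shows "pair_graph (graph_power H m)"
proof -
  interpret pair_graph H by fact
  have "parcs (graph_power H m) \<subseteq> pverts H \<times> pverts H"
    by (auto simp: graph_power_def)
  then have "finite (parcs (graph_power H m))"
    by (rule finite_subset) simp
  then show ?thesis
    by unfold_locales
      (auto simp: graph_power_def symmetric_def graph_dist_commute[OF assms] intro!: symI)
qed

lemma sd_vertex_0: "sd_vertex n u v 0 = replicate_mset n u"
  by (simp add: sd_vertex_def)

lemma sd_vertex_n: "sd_vertex n u v n = replicate_mset n v"
  by (simp add: sd_vertex_def)

lemma sd_vertex_swap: "i \<le> n \<Longrightarrow> sd_vertex n v u (n - i) = sd_vertex n u v i"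
  by (simp add: sd_vertex_def add.commute)

lemma count_sd_vertex:
  "count (sd_vertex n u v i) w = (if w = u then n - i else 0) + (if w = v then i else 0)"
  by (simp add: sd_vertex_def)

lemma sd_vertex_eq_iff:
  assumes "u \<noteq> v" "u' \<noteq> v'" "0 < i" "i < n" "0 < j" "j < n"
  shows "sd_vertex n u v i = sd_vertex n u' v' j \<longleftrightarrow>
    u' = u \<and> v' = v \<and> j = i \<or> u' = v \<and> v' = u \<and> j = n - i"
proof
  assume eq: "sd_vertex n u v i = sd_vertex n u' v' j"
  have "set_mset (sd_vertex n u v i) = {u, v}" "set_mset (sd_vertex n u' v' j) = {u', v'}"
    using assms by (auto simp: sd_vertex_def)
  with eq have "u' = u \<and> v' = v \<or> u' = v \<and> v' = u"
    by (auto simp: doubleton_eq_iff)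
  moreover have "count (sd_vertex n u v i) v = count (sd_vertex n u' v' j) v"
    using eq by simp
  ultimately show "u' = u \<and> v' = v \<and> j = i \<or> u' = v \<and> v' = u \<and> j = n - i"
    using assms by (auto simp: count_sd_vertex)
next
  assume "u' = u \<and> v' = v \<and> j = i \<or> u' = v \<and> v' = u \<and> j = n - i"
  then show "sd_vertex n u v i = sd_vertex n u' v' j"
    using assms sd_vertex_swap[of i n v u] by auto
qed

lemma sd_vertex_in_verts:
  assumes "pair_graph G" "(u, v) \<in> parcs G" "i \<le> n"
  shows "sd_vertex n u v i \<in> pverts (n_subdivision G n)"
proof -
  interpret pair_graph G by fact
  consider "i = 0" | "i = n" | "0 < i" "i < n" using assms(3) by linarith
  then show ?thesis
    using assms(2) in_arcsD1[OF assms(2)] in_arcsD2[OF assms(2)]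
    by cases (auto simp: n_subdivision_def sd_vertex_0 sd_vertex_n)
qed

lemma pair_graph_n_subdivision:
  assumes "pair_graph G"
  shows "pair_graph (n_subdivision G n)"
proof -
  interpret pair_graph G by fact
  let ?H = "n_subdivision G n"
  let ?f = "\<lambda>((u, v), i). sd_vertex n u v i"
  have "pverts ?H \<subseteq> replicate_mset n ` pverts G \<union> ?f ` (parcs G \<times> {..<n})"
    by (force simp: n_subdivision_def)
  then have fin: "finite (pverts ?H)"
    by (rule finite_subset) simp
  have sub: "parcs ?H \<subseteq> pverts ?H \<times> pverts ?H"
  proof
    fix e assume "e \<in> parcs ?H"
    then obtain u v i where "(u, v) \<in> parcs G" "i < n"
      "e = (sd_vertex n u v i, sd_vertex n u v (i + 1)) \<or>
       e = (sd_vertex n u v (i + 1), sd_vertex n u v i)"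
      unfolding n_subdivision_def by auto
    then show "e \<in> pverts ?H \<times> pverts ?H"
      using sd_vertex_in_verts[OF assms, of u v i n] sd_vertex_in_verts[OF assms, of u v "i + 1" n]
      by auto
  qed
  have neq: "sd_vertex n u v i \<noteq> sd_vertex n u v (i + 1)" if "(u, v) \<in> parcs G" for u v i
  proof -
    have "count (sd_vertex n u v i) v \<noteq> count (sd_vertex n u v (i + 1)) v"
      using that no_loops' by (auto simp: count_sd_vertex)
    then show ?thesis by metis
  qed
  have "sym (parcs ?H)"
    by (auto simp: n_subdivision_def intro!: symI)
  moreover have "fst e \<noteq> snd e" if "e \<in> parcs ?H" for e
    using that neq neq[symmetric] by (auto simp: n_subdivision_def simp del: One_nat_def)
  ultimately show ?thesis
    using fin sub finite_subset[OF sub]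
    by unfold_locales (auto simp: symmetric_def)
qed

lemma pair_graph_fractional_power: "pair_graph G \<Longrightarrow> pair_graph (fractional_power G m n)"
  unfolding fractional_power_def by (intro pair_graph_power pair_graph_n_subdivision)

end

theory Submission
  imports Defs
begin

text \<open>
  Write \<open>k = m div 2\<close>.  The ball of radius \<open>k\<close> around a vertex of maximum degree \<open>\<Delta>\<close> in the
  subdivision, for odd \<open>m\<close> together with one vertex at distance \<open>k + 1\<close>, is a clique of size
  \<open>K = k * \<Delta> + 1 + m mod 2\<close> in the fractional power, so it suffices to colour with \<open>K\<close> colours: a colour \<open>0\<close> for all original vertices, \<open>\<Delta>\<close> blocks of \<open>k\<close>
  colours and, for odd \<open>m\<close>, one more colour \<open>z\<close>.  Give distinct blocks to the arcs leaving a vertex.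
  The first \<open>m + 1\<close> positions of the path of an arc with block \<open>a\<close> are coloured
  \<open>0, a\<^sub>1, \<dots>, a\<^sub>k, (z,) c\<^sub>k, \<dots>, c\<^sub>1\<close> with some block \<open>c \<noteq> a\<close>; the descending order makes
  the colours of different arcs at a vertex compatible.  For an edge with blocks \<open>a\<close>, \<open>b\<close> at its
  ends, the second blocks \<open>c \<noteq> a\<close>, \<open>d \<noteq> b\<close> are also chosen distinct from each other, which makes
  both ends of the path compatible since \<open>n \<ge> 2 * m + 2\<close>.  The remaining inner positions see at
  most \<open>2 * m < K\<close> others and are coloured greedily.
\<close>

section \<open>Cliques and colourings\<close>

lemma card_clique_le_colors:
  assumes "clique G C" "proper_coloring G c" "c ` pverts G \<subseteq> {..<k::nat}"
  shows "card C \<le> k"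
proof -
  have "inj_on c C"
    using assms(1,2) unfolding inj_on_def clique_def proper_coloring_def by blast
  moreover have "c ` C \<subseteq> {..<k}"
    using assms(1,3) unfolding clique_def by blast
  ultimately show ?thesis
    using card_inj_on_le[of c C "{..<k}"] by simp
qed

text \<open>A sandwich: the clique puts the clique number at \<open>k\<close> or more, the colouring
  puts the chromatic number at \<open>k\<close> or less, and \<open>card_clique_le_colors\<close>
  bounds every clique by the chromatic number.\<close>

lemma chromatic_eq_clique_number:
  assumes "finite (pverts G)"
    and "clique G C" "card C = k"
    and "proper_coloring G c" "c ` pverts G \<subseteq> {..<k::nat}"
  shows "chromatic_number G = clique_number G"
proof -
  let ?P = "\<lambda>k. \<exists>c :: 'a \<Rightarrow> nat. c ` pverts G \<subseteq> {..<k} \<and> proper_coloring G c"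
  have k: "?P k" using assms by blast
  then have le: "chromatic_number G \<le> k"
    unfolding chromatic_number_def by (rule Least_le)
  have "?P (chromatic_number G)"
    unfolding chromatic_number_def using k by (rule LeastI)
  then have bound: "card D \<le> chromatic_number G" if "clique G D" for D
    using card_clique_le_colors[OF that] by blast
  have "{card C |C. clique G C} \<subseteq> card ` Pow (pverts G)"
    by (auto simp: clique_def)
  then have fin: "finite {card C |C. clique G C}"
    using assms(1) by (rule_tac finite_subset) auto
  have "k \<le> clique_number G"
    unfolding clique_number_def using fin assms(2,3) by (intro Max_ge) auto
  moreover have "clique_number G \<le> chromatic_number G"
    unfolding clique_number_def using fin assms(2) bound by (subst Max_le_iff) auto
  ultimately show ?thesis using le by linarith
qed

lemma graph_dist_ge_1:
  assumes "pair_graph G" "u \<noteq> v"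
  shows "1 \<le> graph_dist G u v"
proof -
  interpret pair_graph G by fact
  have cost: "awalk_cost (\<lambda>_. 1) p = real (length p)" for p :: "('a \<times> 'a) list"
    by (induct p) simp_all
  have "1 \<le> length p" if "awalk u p v" for p
    using that assms(2) by (cases p) (auto simp: awalk_Nil_iff)
  then show ?thesis
    unfolding graph_dist_def \<mu>_def by (intro INF_greatest) (auto simp: cost one_ereal_def)
qed

section \<open>Short walks in the subdivision\<close>

lemma pair_graph_arc_neq:
  assumes "pair_graph G" "(u, v) \<in> parcs G"
  shows "u \<noteq> v"
proof -
  interpret pair_graph G by fact
  show ?thesis using assms(2) no_loops' by auto
qed

lemma pair_graph_arc_sym:
  assumes "pair_graph G" "(u, v) \<in> parcs G"
  shows "(v, u) \<in> parcs G"
proof -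
  interpret pair_graph G by fact
  show ?thesis using assms(2) arcs_symmetric by auto
qed

lemma finite_out_neighbors:
  assumes "pair_graph G"
  shows "finite {v. (u, v) \<in> parcs G}"
proof -
  interpret pair_graph G by fact
  have "{v. (u, v) \<in> parcs G} \<subseteq> snd ` parcs G" by force
  then show ?thesis by (rule finite_subset) simp
qed

text \<open>The support of the multiset decides. It has one element for an original vertex (first
  four cases) and two for an inner vertex, which fixes the edge path up to reversal (last two
  cases).\<close>

lemma sd_vertex_eq_cases:
  assumes eq: "sd_vertex n u v i = sd_vertex n u' v' j"
    and ne: "u \<noteq> v" "u' \<noteq> v'" and le: "i \<le> n" "j \<le> n" and n: "0 < n"
  obtains "i = 0" "j = 0" "u' = u" | "i = 0" "j = n" "v' = u"
    | "i = n" "j = 0" "u' = v" | "i = n" "j = n" "v' = v"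
    | "u' = u" "v' = v" "j = i" | "u' = v" "v' = u" "j = n - i"
proof -
  have set: "set_mset (sd_vertex n a b l) = (if l < n then {a} else {}) \<union> (if 0 < l then {b} else {})"
    if "l \<le> n" for a b l
    using that by (auto simp: sd_vertex_def)
  have "set_mset (sd_vertex n u v i) = set_mset (sd_vertex n u' v' j)"
    using eq by simp
  then have sets: "(if i < n then {u} else {}) \<union> (if 0 < i then {v} else {}) =
      (if j < n then {u'} else {}) \<union> (if 0 < j then {v'} else {})"
    using le by (simp add: set)
  show thesis
  proof (cases "0 < i \<and> i < n")
    case True
    then have "{u, v} = (if j < n then {u'} else {}) \<union> (if 0 < j then {v'} else {})"
      using sets True by (simp add: insert_commute)
    then have "0 < j" "j < n" using ne n by (auto split: if_splits)
    then show thesis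
      using sd_vertex_eq_iff[OF ne, of i n j] True eq that(5,6) by blast
  next
    case False
    then consider "i = 0" | "i = n" using le by linarith
    then show thesis
      using sets ne le n that(1-4) by cases (auto split: if_splits)
  qed
qed

lemma n_subdivision_arc_cases:
  assumes G: "pair_graph G" and uv: "(u, v) \<in> parcs G" and j: "j \<le> n"
    and arc: "(sd_vertex n u v j, y) \<in> parcs (n_subdivision G n)"
  obtains "j < n" "y = sd_vertex n u v (j + 1)"
    | "0 < j" "y = sd_vertex n u v (j - 1)"
    | q where "j = 0" "(u, q) \<in> parcs G" "y = sd_vertex n u q 1"
    | q where "j = n" "(v, q) \<in> parcs G" "y = sd_vertex n v q 1"
proof -
  \<comment> \<open>Reversing the edge of \<open>G\<close> turns a backward arc of the subdivision
    into a forward one, so only steps from \<open>t\<close> to \<open>t + 1\<close> remain.\<close>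
  obtain p q t where pq: "(p, q) \<in> parcs G" and t: "t < n"
    and eq: "sd_vertex n u v j = sd_vertex n p q t" and y: "y = sd_vertex n p q (t + 1)"
  proof -
    obtain p q t where pq: "(p, q) \<in> parcs G" and t: "t < n"
      and or: "sd_vertex n u v j = sd_vertex n p q t \<and> y = sd_vertex n p q (t + 1) \<or>
        sd_vertex n u v j = sd_vertex n p q (t + 1) \<and> y = sd_vertex n p q t"
      using arc unfolding n_subdivision_def by auto
    from or show thesis
    proof
      assume "sd_vertex n u v j = sd_vertex n p q t \<and> y = sd_vertex n p q (t + 1)"
      then show thesis using pq t that by blast
    next
      assume *: "sd_vertex n u v j = sd_vertex n p q (t + 1) \<and> y = sd_vertex n p q t"
      have "sd_vertex n q p (n - (t + 1)) = sd_vertex n p q (t + 1)"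
        "sd_vertex n q p (n - t) = sd_vertex n p q t"
        using t by (auto intro: sd_vertex_swap)
      moreover have "n - (t + 1) + 1 = n - t" using t by simp
      ultimately show thesis
        using * pair_graph_arc_sym[OF G pq] t that[of q p "n - (t + 1)"] by auto
    qed
  qed
  have ne: "u \<noteq> v" "p \<noteq> q" using uv pq pair_graph_arc_neq[OF G] by auto
  have t': "t \<le> n" "0 < n" using t by auto
  from eq ne j t' show thesis
  proof (cases rule: sd_vertex_eq_cases)
    \<comment> \<open>Here \<open>(p, q)\<close> is \<open>(v, u)\<close>, so a step forward along
      it is a step back along \<open>(u, v)\<close>.\<close>
    case 6
    have "sd_vertex n p q (t + 1) = sd_vertex n u v (n - (t + 1))"
      using 6 t sd_vertex_swap[of "t + 1" n q p] by (simp only:)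
    moreover have "n - (t + 1) = j - 1" "0 < j" using 6 t j by auto
    ultimately show thesis using that(2) y by simp
  qed (use t pq y that in auto)
qed

text \<open>
  For \<open>l < n\<close> this describes the pairs of vertices joined by a walk of length at most \<open>l\<close>: they lie
  on the path of one edge, or on the paths of two edges with a common end.
\<close>

definition sd_near :: "'a pair_pre_digraph \<Rightarrow> nat \<Rightarrow> nat \<Rightarrow> 'a multiset \<Rightarrow> 'a multiset \<Rightarrow> bool" where
  "sd_near G n l x y \<longleftrightarrow>
    (\<exists>u v i j. (u, v) \<in> parcs G \<and> i \<le> n \<and> j \<le> n \<and> i \<le> j + l \<and> j \<le> i + l \<and>
      x = sd_vertex n u v i \<and> y = sd_vertex n u v j) \<or>
    (\<exists>u v v' i j. (u, v) \<in> parcs G \<and> (u, v') \<in> parcs G \<and> v \<noteq> v' \<and> i + j \<le> l \<and>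
      x = sd_vertex n u v i \<and> y = sd_vertex n u v' j)"

lemma sd_near_pathI:
  assumes "(u, v) \<in> parcs G" "i \<le> n" "j \<le> n" "i \<le> j + l" "j \<le> i + l"
  shows "sd_near G n l (sd_vertex n u v i) (sd_vertex n u v j)"
  unfolding sd_near_def using assms
  by (intro disjI1 exI[of _ u] exI[of _ v] exI[of _ i] exI[of _ j]) simp

lemma sd_near_forkI:
  assumes "(u, v) \<in> parcs G" "(u, v') \<in> parcs G" "v \<noteq> v'" "i + j \<le> l"
  shows "sd_near G n l (sd_vertex n u v i) (sd_vertex n u v' j)"
  unfolding sd_near_def using assms
  by (intro disjI2 exI[of _ u] exI[of _ v] exI[of _ v'] exI[of _ i] exI[of _ j]) simp

lemma sd_near_mono:
  assumes "sd_near G n l x y" "l \<le> l'"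
  shows "sd_near G n l' x y"
  using assms(1)[unfolded sd_near_def]
proof (elim disjE exE conjE)
  fix u v i j
  assume "(u, v) \<in> parcs G" "i \<le> n" "j \<le> n" "i \<le> j + l" "j \<le> i + l"
    "x = sd_vertex n u v i" "y = sd_vertex n u v j"
  then show ?thesis using sd_near_pathI[of u v G i n j l'] assms(2) by simp
next
  fix u v v' i j
  assume "(u, v) \<in> parcs G" "(u, v') \<in> parcs G" "v \<noteq> v'" "i + j \<le> l"
    "x = sd_vertex n u v i" "y = sd_vertex n u v' j"
  then show ?thesis using sd_near_forkI[of u v G v' i j l' n] assms(2) by simp
qed

text \<open>A walk at the original vertex \<open>u\<close> may continue on any edge path there: the
  path it came from gives a pair on one path, any other path opens a fork.\<close>

lemma sd_near_turn:
  assumes "(u, v) \<in> parcs G" "(u, q) \<in> parcs G" "i \<le> l" "l < n"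
  shows "sd_near G n (Suc l) (sd_vertex n u v i) (sd_vertex n u q 1)"
proof (cases "q = v")
  case True
  then show ?thesis using sd_near_pathI[of u v G i n 1 "Suc l"] assms by simp
next
  case False
  then show ?thesis using sd_near_forkI[of u v G q i 1 "Suc l"] assms by simp
qed

text \<open>A pair changes its shape only when \<open>y\<close> is an original vertex, where
  \<open>sd_near_turn\<close> applies. In a fork, \<open>i + j \<le> l < n\<close> keeps
  \<open>y\<close> short of the far end \<open>v'\<close>, so no third edge path comes into
  play.\<close>

lemma sd_near_step:
  assumes G: "pair_graph G" and near: "sd_near G n l x y"
    and arc: "(y, z) \<in> parcs (n_subdivision G n)" and l: "l < n"
  shows "sd_near G n (Suc l) x z"
proof -
  have path: "sd_near G n (Suc l) x z"
    if uv: "(u, v) \<in> parcs G" and ij: "i \<le> n" "j \<le> n" "i \<le> j + l" "j \<le> i + l"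
      and x: "x = sd_vertex n u v i" and y: "y = sd_vertex n u v j" for u v i j
    using G uv ij(2) arc[unfolded y]
  proof (cases rule: n_subdivision_arc_cases)
    case 1
    then show ?thesis unfolding x using uv ij by (simp only:) (intro sd_near_pathI; simp)
  next
    case 2
    then show ?thesis unfolding x using uv ij by (simp only:) (intro sd_near_pathI; simp)
  next
    case (3 q)
    then show ?thesis unfolding x using uv ij l by (simp add: sd_near_turn del: One_nat_def)
  next
    case (4 q)
    have "x = sd_vertex n v u (n - i)" unfolding x using ij by (simp add: sd_vertex_swap)
    then show ?thesis
      using 4 ij l pair_graph_arc_sym[OF G uv] by (simp add: sd_near_turn del: One_nat_def)
  qed
  from near[unfolded sd_near_def] show ?thesis
  proof (elim disjE exE conjE)
    fix u v v' i j
    assume uv: "(u, v) \<in> parcs G" "(u, v') \<in> parcs G" "v \<noteq> v'" and ij: "i + j \<le> l"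
      and x: "x = sd_vertex n u v i" and y: "y = sd_vertex n u v' j"
    have "j \<le> n" using ij l by simp
    from G uv(2) this arc[unfolded y] show ?thesis
    proof (cases rule: n_subdivision_arc_cases)
      case 1
      then show ?thesis unfolding x using uv ij by (simp only:) (intro sd_near_forkI; simp)
    next
      case 2
      then show ?thesis unfolding x using uv ij by (simp only:) (intro sd_near_forkI; simp)
    next
      case (3 q)
      then show ?thesis unfolding x using uv ij l by (simp add: sd_near_turn del: One_nat_def)
    qed (use ij l in simp)
  qed (rule path)
qed

lemma n_subdivision_arc_near:
  assumes "(x, y) \<in> parcs (n_subdivision G n)"
  shows "sd_near G n 1 x y"
proof -
  obtain u v i where uv: "(u, v) \<in> parcs G" "i < n"
    and "x = sd_vertex n u v i \<and> y = sd_vertex n u v (i + 1) \<or>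
      x = sd_vertex n u v (i + 1) \<and> y = sd_vertex n u v i"
    using assms unfolding n_subdivision_def by auto
  then show ?thesis
    using sd_near_pathI[of u v G i n "i + 1" 1] sd_near_pathI[of u v G "i + 1" n i 1] by auto
qed

text \<open>The alternative \<open>x = y\<close> covers the empty walk, also at an isolated vertex
  of \<open>G\<close>, which lies on no edge path and so is not \<open>sd_near\<close>
  itself.\<close>

lemma n_subdivision_walk_near:
  assumes G: "pair_graph G"
    and "pre_digraph.awalk (with_proj (n_subdivision G n)) x p y" "length p < n"
  shows "x = y \<or> sd_near G n (length p) x y"
proof -
  interpret H: pair_graph "n_subdivision G n" using G by (rule pair_graph_n_subdivision)
  show ?thesis using assms(2,3)
  proof (induction p arbitrary: y rule: rev_induct)
    case Nil
    then show ?case by (simp add: H.awalk_Nil_iff)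
  next
    case (snoc e p)
    obtain w where w: "H.awalk x p w" "H.awalk w [e] y"
      using snoc.prems(1) by (auto simp: H.awalk_append_iff)
    then have arc: "(w, y) \<in> parcs (n_subdivision G n)"
      by (cases e) (auto simp: H.awalk_Cons_iff H.awalk_Nil_iff)
    from snoc.IH[OF w(1)] snoc.prems(2) consider "x = w" | "sd_near G n (length p) x w"
      by auto
    then show ?case
    proof cases
      case 1
      then have "sd_near G n 1 x y" using n_subdivision_arc_near[OF arc] by simp
      then show ?thesis
        using sd_near_mono[of G n 1 x y "length (p @ [e])"] by simp
    next
      case 2
      then show ?thesis using sd_near_step[OF G _ arc] snoc.prems(2) by simp
    qed
  qed
qed

lemma fractional_power_arcD:
  assumes G: "pair_graph G" and arc: "(x, y) \<in> parcs (fractional_power G m n)" and "m < n"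
  shows "sd_near G n m x y" "x \<noteq> y"
proof -
  show ne: "x \<noteq> y" using arc by (simp add: fractional_power_def graph_power_def)
  have "graph_dist (n_subdivision G n) x y \<le> ereal (real m)"
    using arc by (simp add: fractional_power_def graph_power_def)
  then obtain p where p: "pre_digraph.awalk (with_proj (n_subdivision G n)) x p y" "length p \<le> m"
    unfolding graph_dist_le_iff[OF pair_graph_n_subdivision[OF G]] by blast
  then have "sd_near G n (length p) x y"
    using n_subdivision_walk_near[OF G p(1)] ne assms(3) by simp
  then show "sd_near G n m x y"
    using p(2) by (rule sd_near_mono)
qed

section \<open>The clique around a vertex of maximum degree\<close>

lemma n_subdivision_walk_from_end:
  assumes G: "pair_graph G" and uv: "(u, v) \<in> parcs G" and "i \<le> n"
  shows "\<exists>p. pre_digraph.awalk (with_proj (n_subdivision G n)) (sd_vertex n u v 0) p (sd_vertex n u v i)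
    \<and> length p = i"
proof -
  interpret H: pair_graph "n_subdivision G n" using G by (rule pair_graph_n_subdivision)
  show ?thesis using \<open>i \<le> n\<close>
  proof (induction i)
    case 0
    have "H.awalk (sd_vertex n u v 0) [] (sd_vertex n u v 0)"
      using sd_vertex_in_verts[OF G uv, of 0 n] by (simp add: H.awalk_Nil_iff)
    then show ?case by (intro exI[of _ "[]"]) simp
  next
    case (Suc i)
    then obtain p where p: "H.awalk (sd_vertex n u v 0) p (sd_vertex n u v i)" "length p = i"
      by auto
    have "(sd_vertex n u v i, sd_vertex n u v (Suc i)) \<in> parcs (n_subdivision G n)"
      using uv Suc.prems unfolding n_subdivision_def by fastforce
    then have "H.awalk (sd_vertex n u v i) [(sd_vertex n u v i, sd_vertex n u v (Suc i))]
        (sd_vertex n u v (Suc i))"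
      using H.arc_implies_awalk by fastforce
    then have "H.awalk (sd_vertex n u v 0)
        (p @ [(sd_vertex n u v i, sd_vertex n u v (Suc i))]) (sd_vertex n u v (Suc i))"
      using p(1) H.awalk_appendI by blast
    moreover have "length (p @ [(sd_vertex n u v i, sd_vertex n u v (Suc i))]) = Suc i"
      using p(2) by simp
    ultimately show ?case by blast
  qed
qed

text \<open>Going back from position \<open>i\<close> to \<open>u\<close> and then out to position
  \<open>j\<close> is a walk of length \<open>i + j\<close>. It need not be shortest, so
  \<open>v = v'\<close> is allowed.\<close>

lemma fractional_power_arcI:
  assumes G: "pair_graph G" and arcs: "(u, v) \<in> parcs G" "(u, v') \<in> parcs G"
    and ij: "i \<le> n" "j \<le> n" "i + j \<le> m"
    and ne: "sd_vertex n u v i \<noteq> sd_vertex n u v' j"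
  shows "(sd_vertex n u v i, sd_vertex n u v' j) \<in> parcs (fractional_power G m n)"
proof -
  interpret H: pair_graph "n_subdivision G n" using G by (rule pair_graph_n_subdivision)
  obtain p where p: "H.awalk (sd_vertex n u v 0) p (sd_vertex n u v i)" "length p = i"
    using n_subdivision_walk_from_end[OF G arcs(1) ij(1)] by blast
  obtain q where q: "H.awalk (sd_vertex n u v' 0) q (sd_vertex n u v' j)" "length q = j"
    using n_subdivision_walk_from_end[OF G arcs(2) ij(2)] by blast
  have len: "length (rev_path r) = length r" for r :: "('a multiset \<times> 'a multiset) list"
    by (induct r) simp_all
  have "H.awalk (sd_vertex n u v i) (rev_path p @ q) (sd_vertex n u v' j)"
    using p(1) q(1) by (intro H.awalk_appendI) (auto simp: sd_vertex_0)
  moreover have "length (rev_path p @ q) \<le> m" using p(2) q(2) ij by (simp add: len)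
  ultimately have "graph_dist (n_subdivision G n) (sd_vertex n u v i) (sd_vertex n u v' j)
      \<le> ereal (real m)"
    unfolding graph_dist_le_iff[OF pair_graph_n_subdivision[OF G]] by blast
  then show ?thesis
    using ne graph_dist_ge_1[OF pair_graph_n_subdivision[OF G] ne]
      sd_vertex_in_verts[OF G arcs(1) ij(1)] sd_vertex_in_verts[OF G arcs(2) ij(2)]
    by (simp add: fractional_power_def graph_power_def)
qed

text \<open>Two positions up to \<open>k\<close> sum to at most \<open>2 * k\<close>, and the extra
  vertex at \<open>k + 1\<close> is only there for odd \<open>m\<close>, where
  \<open>k + (k + 1) = m\<close>. So any two members are joined by a walk of length at most
  \<open>m\<close> through \<open>u\<close>.\<close>

lemma fractional_power_clique:
  assumes G: "pair_graph G" and N: "N = {v. (u, v) \<in> parcs G}" "N \<noteq> {}" and m: "0 < m" "m < n"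
  shows "\<exists>C. clique (fractional_power G m n) C \<and> card C = (m div 2) * card N + 1 + m mod 2"
proof -
  define k where "k = m div 2"
  have mk: "m = 2 * k + m mod 2" by (simp add: k_def)
  then have k1: "2 * k \<le> m" "odd m \<Longrightarrow> 2 * k + 1 \<le> m" by presburger+
  obtain v0 where v0: "v0 \<in> N" using N by blast
  have finN: "finite N" unfolding N by (rule finite_out_neighbors[OF G])
  define f where "f = (\<lambda>(v, i). sd_vertex n u v i)"
  \<comment> \<open>Position 0 is left out, since it is \<open>u\<close> on every path; this makes
    \<open>f\<close> injective on \<open>I\<close>, and \<open>u\<close> is added once, as seen from
    \<open>v0\<close>.\<close>
  define I where "I = N \<times> {1..k} \<union> (if odd m then {(v0, k + 1)} else {})"
  define C where "C = insert (sd_vertex n u v0 0) (f ` I)"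
  have arc: "(u, v) \<in> parcs G" if "v \<in> N" for v using that N by simp
  have ne: "u \<noteq> v" if "v \<in> N" for v using arc[OF that] pair_graph_arc_neq[OF G] by simp
  have finI: "finite I" unfolding I_def using finN by simp
  have cardI: "card I = k * card N + m mod 2"
  proof (cases "odd m")
    case True
    then have "I = insert (v0, k + 1) (N \<times> {1..k})" unfolding I_def by simp
    then show ?thesis using finN True by (simp add: odd_iff_mod_2_eq_one)
  next
    case False
    then show ?thesis unfolding I_def by (simp add: even_iff_mod_2_eq_zero card_cartesian_product)
  qed
  have I: "v \<in> N" "0 < i" "i < n" "i \<le> k \<or> odd m \<and> v = v0 \<and> i = k + 1" if "(v, i) \<in> I" for v i
    using that v0 m k1 unfolding I_def by (auto split: if_splits)
  have "inj_on f I"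
  proof (rule inj_onI, clarify)
    fix v i v' i' assume "(v, i) \<in> I" "(v', i') \<in> I" "f (v, i) = f (v', i')"
    then show "v = v' \<and> i = i'"
      using sd_vertex_eq_iff[of u v u v' i n i'] I[of v i] I[of v' i'] ne
      by (auto simp: f_def)
  qed
  moreover have "sd_vertex n u v0 0 \<notin> f ` I"
  proof
    assume "sd_vertex n u v0 0 \<in> f ` I"
    then obtain v i where vi: "(v, i) \<in> I" "sd_vertex n u v0 0 = sd_vertex n u v i"
      by (auto simp: f_def)
    then have "count (sd_vertex n u v0 0) u = count (sd_vertex n u v i) u" by simp
    then show False using I[OF vi(1)] ne v0 by (auto simp: count_sd_vertex)
  qed
  ultimately have "card C = k * card N + 1 + m mod 2"
    unfolding C_def using finI cardI by (simp add: card_image)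
  moreover have "clique (fractional_power G m n) C"
    unfolding clique_def
  proof (intro conjI ballI impI)
    have C: "\<exists>v i. (v \<in> N \<and> i < n \<and> (i \<le> k \<or> odd m \<and> v = v0 \<and> i = k + 1)) \<and> x = sd_vertex n u v i"
      if "x \<in> C" for x
      using that unfolding C_def
    proof
      assume "x = sd_vertex n u v0 0"
      then show ?thesis using v0 m by (intro exI[of _ v0] exI[of _ 0]) simp
    next
      assume "x \<in> f ` I"
      then obtain v i where "(v, i) \<in> I" "x = sd_vertex n u v i" by (auto simp: f_def)
      then show ?thesis using I[of v i] by blast
    qed
    show "C \<subseteq> pverts (fractional_power G m n)"
    proof
      fix x assume "x \<in> C"
      from C[OF this] obtain v i where "v \<in> N" "i < n" "x = sd_vertex n u v i" by blast
      then show "x \<in> pverts (fractional_power G m n)"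
        using sd_vertex_in_verts[OF G arc, of v i n]
        by (simp add: fractional_power_def graph_power_def)
    qed
    fix x y assume "x \<in> C" "y \<in> C" and xy: "x \<noteq> y"
    from C[OF this(1)] C[OF this(2)] obtain v i v' j
      where vi: "v \<in> N" "i < n" "i \<le> k \<or> odd m \<and> v = v0 \<and> i = k + 1" "x = sd_vertex n u v i"
        and vj: "v' \<in> N" "j < n" "j \<le> k \<or> odd m \<and> v' = v0 \<and> j = k + 1" "y = sd_vertex n u v' j"
      by blast
    have "i + j \<le> m" using vi vj xy k1 by auto
    then show "(x, y) \<in> parcs (fractional_power G m n)"
      using fractional_power_arcI[OF G arc arc, of v v' i n j m] vi vj xy by auto
  qed
  ultimately show ?thesis unfolding k_def by blast
qed

section \<open>Colouring a path\<close>

definition path_proper :: "nat \<Rightarrow> nat set \<Rightarrow> (nat \<Rightarrow> 'c) \<Rightarrow> bool" where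
  "path_proper m S f \<longleftrightarrow> (\<forall>i\<in>S. \<forall>j\<in>S. i < j \<and> j \<le> i + m \<longrightarrow> f i \<noteq> f j)"

text \<open>Greedy colouring, one position of \<open>T\<close> at a time: at most
  \<open>2 * m\<close> other positions lie within distance \<open>m\<close>, so fewer than
  \<open>K\<close> colours are forbidden.\<close>

lemma path_proper_extend:
  fixes f :: "nat \<Rightarrow> nat"
  assumes "finite T" "path_proper m S f" "f ` S \<subseteq> {..<K}" "2 * m < K"
  shows "\<exists>g. (\<forall>i\<in>S. g i = f i) \<and> path_proper m (S \<union> T) g \<and> g ` (S \<union> T) \<subseteq> {..<K}"
  using assms(1)
proof induction
  case empty
  then show ?case using assms by auto
next
  case (insert t T)
  then obtain g where g: "\<forall>i\<in>S. g i = f i" "path_proper m (S \<union> T) g" "g ` (S \<union> T) \<subseteq> {..<K}"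
    by blast
  show ?case
  proof (cases "t \<in> S")
    case True
    then show ?thesis using g by (intro exI[of _ g]) (auto simp: insert_absorb)
  next
    case False
    let ?W = "{t - m..<t} \<union> {t<..t + m}"
    have "card (g ` ?W) \<le> card ?W" by (rule card_image_le) simp
    also have "\<dots> \<le> card {t - m..<t} + card {t<..t + m}" by (rule card_Un_le)
    also have "\<dots> \<le> 2 * m" by simp
    finally have "card (g ` ?W) < card {..<K}" using assms(4) by simp
    then have "\<not> {..<K} \<subseteq> g ` ?W" using card_mono[of "g ` ?W" "{..<K}"] by auto
    then obtain c where c: "c < K" "c \<notin> g ` ?W" by blast
    have "path_proper m (S \<union> insert t T) (g(t := c))"
      unfolding path_proper_def
    proof (intro ballI impI)
      fix i j assume ij: "i \<in> S \<union> insert t T" "j \<in> S \<union> insert t T" "i < j \<and> j \<le> i + m"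
      consider "i = t" | "j = t" | "i \<noteq> t" "j \<noteq> t" by blast
      then show "(g(t := c)) i \<noteq> (g(t := c)) j"
      proof cases
        case 1
        then have "j \<in> ?W" using ij by auto
        then show ?thesis using 1 ij c by auto
      next
        case 2
        then have "i \<in> ?W" using ij by auto
        then show ?thesis using 2 ij c by auto
      next
        case 3
        then show ?thesis using ij g(2) unfolding path_proper_def by auto
      qed
    qed
    moreover have "\<forall>i\<in>S. (g(t := c)) i = f i" using g(1) False by auto
    moreover have "(g(t := c)) ` (S \<union> insert t T) \<subseteq> {..<K}" using g(3) c(1) by auto
    ultimately show ?thesis by blast
  qed
qed

text \<open>
  The colour at distance \<open>i \<le> m\<close> from the end of an edge path with first block \<open>a\<close> and second
  block \<open>c\<close>.  The \<open>i\<close>-th colour of block \<open>a\<close> is \<open>a * (m div 2) + i\<close>, where \<open>1 \<le> i \<le> m div 2\<close>.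
\<close>

definition end_color :: "nat \<Rightarrow> nat \<Rightarrow> nat \<Rightarrow> nat \<Rightarrow> nat \<Rightarrow> nat" where
  "end_color m D a c i =
    (if i = 0 then 0
     else if i \<le> m div 2 then a * (m div 2) + i
     else if m < i + m div 2 then c * (m div 2) + (m + 1 - i)
     else m div 2 * D + 1)"

section \<open>Compatibility of the colours near the ends of edge paths\<close>

lemma block_color_eq_iff:
  fixes k :: nat
  assumes "1 \<le> i" "i \<le> k" "1 \<le> j" "j \<le> k"
  shows "a * k + i = b * k + j \<longleftrightarrow> a = b \<and> i = j"
proof
  assume eq: "a * k + i = b * k + j"
  have *: "a * k + i < b * k + j" if "a < b" "1 \<le> i" "i \<le> k" "1 \<le> j" "j \<le> k" for a b i j
  proof -
    have "Suc a * k \<le> b * k" using that by (intro mult_le_mono1) simp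
    then show ?thesis using that by simp
  qed
  have "a = b"
    using *[of a b i j] *[of b a j i] eq assms by (cases a b rule: linorder_cases) auto
  then show "a = b \<and> i = j" using eq by simp
qed simp

lemma block_color_bounds:
  fixes k :: nat
  assumes "1 \<le> i" "i \<le> k" "a < D"
  shows "0 < a * k + i" "a * k + i \<le> k * D"
proof -
  have "Suc a * k \<le> D * k" using assms by (intro mult_le_mono1) simp
  then show "a * k + i \<le> k * D" using assms by (simp add: mult.commute)
qed (use assms in simp)

text \<open>The case \<open>mid\<close> is the middle position, which exists for odd
  \<open>m\<close> only. In \<open>snd\<close> the index inside the block is the mirrored position
  \<open>i' = m + 1 - i\<close>; the conflict arguments below compare such an index with a
  position.\<close>

lemma end_color_cases:
  assumes "i \<le> m" "a < D" "c < D"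
  obtains (zero) "i = 0" "end_color m D a c i = 0"
    | (fst) "1 \<le> i" "i \<le> m div 2" "end_color m D a c i = a * (m div 2) + i"
        "0 < end_color m D a c i" "end_color m D a c i \<le> m div 2 * D"
    | (mid) "2 * i = m + 1" "end_color m D a c i = m div 2 * D + 1"
    | (snd) i' where "i + i' = m + 1" "1 \<le> i'" "i' \<le> m div 2"
        "end_color m D a c i = c * (m div 2) + i'"
        "0 < end_color m D a c i" "end_color m D a c i \<le> m div 2 * D"
proof -
  consider "i = 0" | "0 < i" "i \<le> m div 2" | "m div 2 < i" "m < i + m div 2"
    | "m div 2 < i" "i + m div 2 \<le> m"
    by linarith
  then show thesis
  proof cases
    case 1
    then show ?thesis using zero by (simp add: end_color_def)
  next
    case 2
    then show ?thesis
      using fst block_color_bounds[of i "m div 2" a D] assms by (simp add: end_color_def)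
  next
    case 3
    then show ?thesis
      using snd[of "m + 1 - i"] block_color_bounds[of "m + 1 - i" "m div 2" c D] assms by (simp add: end_color_def)
  next
    case 4
    then show ?thesis
      using mid by (simp add: end_color_def)
  qed
qed

lemma end_color_less:
  assumes "i \<le> m" "a < D" "c < D"
  shows "end_color m D a c i < m div 2 * D + 1 + m mod 2"
  using assms
proof (cases rule: end_color_cases)
  case mid
  then have "m mod 2 = 1" by presburger
  then show ?thesis using mid by simp
qed simp_all

lemma end_color_inj:
  assumes "i \<le> m" "j \<le> m" "a < D" "c < D" "a \<noteq> c" "i \<noteq> j"
  shows "end_color m D a c i \<noteq> end_color m D a c j"
  using assms(1,3,4)
proof (cases rule: end_color_cases)
  case zero
  from assms(2-4) show ?thesis by (cases rule: end_color_cases) (use zero assms in auto)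
next
  case fst
  from assms(2-4) show ?thesis
    by (cases rule: end_color_cases) (use fst assms in \<open>auto simp: block_color_eq_iff\<close>)
next
  case mid
  from assms(2-4) show ?thesis by (cases rule: end_color_cases) (use mid assms in auto)
next
  case snd
  from assms(2-4) show ?thesis
    by (cases rule: end_color_cases) (use snd assms in \<open>auto simp: block_color_eq_iff\<close>)
qed

text \<open>One of the positions, say \<open>j\<close>, is in the first half and has index
  \<open>j\<close> in block \<open>a'\<close>. If \<open>i\<close> is also in the first half, the
  blocks differ. If \<open>i\<close> is in the second half, its index \<open>m + 1 - i\<close>
  exceeds \<open>j\<close>, so even \<open>c = a'\<close> does no harm.\<close>

lemma end_color_fork:
  assumes "i + j \<le> m" "1 \<le> i" "1 \<le> j" "a < D" "c < D" "a' < D" "c' < D" "a \<noteq> a'"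
  shows "end_color m D a c i \<noteq> end_color m D a' c' j"
proof -
  have *: "end_color m D a c i \<noteq> end_color m D a' c' j"
    if a: "i + j \<le> m" "1 \<le> i" "1 \<le> j" "a < D" "c < D" "a' < D" "c' < D" "a \<noteq> a'" "j \<le> m div 2"
    for i j a c a' c'
  proof -
    have j: "end_color m D a' c' j = a' * (m div 2) + j" using a by (simp add: end_color_def)
    note b = block_color_bounds[OF a(3,9,6)]
    have "i \<le> m" using a by simp
    from this a(4,5) show ?thesis
      by (cases rule: end_color_cases) (use a j b in \<open>auto simp: block_color_eq_iff\<close>)
  qed
  have "i \<le> m div 2 \<or> j \<le> m div 2" using assms(1) by linarith
  then show ?thesis using *[of i j a c a' c'] *[of j i a' c' a c] assms by fastforce
qed

text \<open>The mirror image of \<open>end_color_fork\<close>: two first halves, or two middles,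
  would violate \<open>m + 2 \<le> i + j\<close>. A first half at \<open>i\<close> against a second
  half at \<open>j\<close> has indices \<open>i\<close> and \<open>m + 1 - j < i\<close>, and two
  second halves use the distinct blocks \<open>c\<close> and \<open>d\<close>.\<close>

lemma end_color_opposite:
  assumes "m + 2 \<le> i + j" "i \<le> m" "j \<le> m" "a < D" "c < D" "b < D" "d < D" "c \<noteq> d"
  shows "end_color m D a c i \<noteq> end_color m D b d j"
  using assms(2,4,5)
proof (cases rule: end_color_cases)
  case zero
  then show ?thesis using assms by simp
next
  case fst
  from assms(3,6,7) show ?thesis
    by (cases rule: end_color_cases) (use fst assms in \<open>auto simp: block_color_eq_iff\<close>)
next
  case mid
  from assms(3,6,7) show ?thesis by (cases rule: end_color_cases) (use mid assms in auto)
next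
  case snd
  from assms(3,6,7) show ?thesis
    by (cases rule: end_color_cases) (use snd assms in \<open>auto simp: block_color_eq_iff\<close>)
qed

text \<open>Only the first blocks \<open>a\<close> and \<open>b\<close> are parameters:
  compatibility with the other paths at a vertex depends on them alone, so the second blocks can
  stay existential.\<close>

definition edge_coloring :: "nat \<Rightarrow> nat \<Rightarrow> nat \<Rightarrow> nat \<Rightarrow> nat \<Rightarrow> (nat \<Rightarrow> nat) \<Rightarrow> bool" where
  "edge_coloring m D n a b f \<longleftrightarrow>
    (\<forall>i\<le>n. f i < m div 2 * D + 1 + m mod 2) \<and> path_proper m {..n} f \<and>
    (\<exists>c<D. \<forall>i\<le>m. f i = end_color m D a c i) \<and>
    (\<exists>d<D. \<forall>i\<le>m. f (n - i) = end_color m D b d i)"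

lemma edge_coloring_rev:
  assumes "edge_coloring m D n a b f" "m \<le> n"
  shows "edge_coloring m D n b a (\<lambda>i. f (n - i))"
proof -
  have "path_proper m {..n} (\<lambda>i. f (n - i))"
    unfolding path_proper_def
  proof (intro ballI impI)
    fix i j assume "i \<in> {..n}" "j \<in> {..n}" "i < j \<and> j \<le> i + m"
    then have "n - j \<in> {..n}" "n - i \<in> {..n}" "n - j < n - i \<and> n - i \<le> n - j + m" by auto
    then show "f (n - i) \<noteq> f (n - j)"
      using assms(1) unfolding edge_coloring_def path_proper_def by metis
  qed
  then show ?thesis
    using assms unfolding edge_coloring_def by simp
qed

lemma edge_coloring_exists:
  assumes "a < D" "b < D" "3 \<le> D" "2 * m + 2 \<le> n" "2 * m < m div 2 * D + 1 + m mod 2"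
  shows "\<exists>f. edge_coloring m D n a b f"
proof -
  define K where "K = m div 2 * D + 1 + m mod 2"
  \<comment> \<open>Three blocks leave at least two candidates for \<open>c\<close> and at least two
    for \<open>d\<close>, hence a distinct pair.\<close>
  have "\<exists>c<3. c \<noteq> a \<and> (\<exists>d<3. d \<noteq> b \<and> c \<noteq> (d::nat))"
  proof -
    have "\<exists>c\<in>{0,1,2::nat}. c \<noteq> a \<and> (\<exists>d\<in>{0,1,2}. d \<noteq> b \<and> c \<noteq> d)" by auto
    then show ?thesis by force
  qed
  then obtain c d where cd: "c < D" "d < D" "c \<noteq> a" "d \<noteq> b" "c \<noteq> d"
    using assms(3) by (meson less_le_trans)
  \<comment> \<open>Only the values on \<open>S\<close>, the two ends of the path, matter; the
    greedy extension replaces all others.\<close>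
  define f where "f i = (if i \<le> m then end_color m D a c i else end_color m D b d (n - i))" for i
  define S where "S = {..m} \<union> {n - m..n}"
  have f_right: "f i = end_color m D b d (n - i)" if "n - m \<le> i" for i
    using that assms(4) by (auto simp: f_def)
  have "path_proper m S f"
    unfolding path_proper_def
  proof (intro ballI impI)
    fix i j assume S: "i \<in> S" "j \<in> S" and ij: "i < j \<and> j \<le> i + m"
    consider "i \<le> m" "j \<le> m" | "n - m \<le> i" "i \<le> n" "n - m \<le> j" "j \<le> n"
      | "i \<le> m" "n - m \<le> j" "j \<le> n"
      using S ij by (fastforce simp: S_def)
    then show "f i \<noteq> f j"
    proof cases
      case 1
      then show ?thesis
        using end_color_inj[of i m j a D c] ij cd assms by (simp add: f_def)
    next
      case 2
      then show ?thesis
        using end_color_inj[of "n - i" m "n - j" b D d] ij cd assms(2)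
        by (simp add: f_right diff_le_mono2 le_diff_conv)
    next
      case 3
      \<comment> \<open>The bound on \<open>n\<close> enters here: positions at distance at most
        \<open>m\<close> have \<open>i + (n - j) \<ge> n - m \<ge> m + 2\<close>.\<close>
      have "m + 2 \<le> i + (n - j)" using 3 ij assms(4) by linarith
      moreover have "n - j \<le> m" using 3 by linarith
      ultimately have "end_color m D a c i \<noteq> end_color m D b d (n - j)"
        using end_color_opposite 3(1) cd assms(1,2) by blast
      then show ?thesis using 3 by (simp only: f_right) (simp add: f_def)
    qed
  qed
  moreover have "f ` S \<subseteq> {..<K}"
    using end_color_less cd assms by (fastforce simp: S_def f_def K_def)
  ultimately obtain g where g: "\<forall>i\<in>S. g i = f i" "path_proper m (S \<union> {..n}) g"
      "g ` (S \<union> {..n}) \<subseteq> {..<K}"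
    using path_proper_extend[of "{..n}" m S f K] assms(5) K_def by auto
  have "S \<union> {..n} = {..n}" using assms(4) by (auto simp: S_def)
  then have "path_proper m {..n} g" "\<forall>i\<le>n. g i < K" using g by auto
  moreover have "\<forall>i\<le>m. g i = end_color m D a c i" using g(1) by (simp add: S_def f_def)
  moreover have "\<forall>i\<le>m. g (n - i) = end_color m D b d i"
  proof (intro allI impI)
    fix i assume "i \<le> m"
    then have "n - i \<in> S" "n - m \<le> n - i" "n - (n - i) = i" using assms(4) by (auto simp: S_def)
    then show "g (n - i) = end_color m D b d i" using g(1) f_right by simp
  qed
  ultimately show ?thesis
    using cd unfolding edge_coloring_def K_def by blast
qed

section \<open>Colouring the fractional power\<close>

text \<open>The out-neighbours of each vertex are numbered separately. The two arcs of an edge may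
  get different blocks, so this is no edge colouring and \<open>D\<close> blocks suffice.\<close>

lemma arc_blocks_exist:
  assumes "pair_graph G" and D: "\<And>u. card {v. (u, v) \<in> parcs G} \<le> D"
  shows "\<exists>b :: 'a \<Rightarrow> 'a \<Rightarrow> nat. \<forall>u v. (u, v) \<in> parcs G \<longrightarrow> b u v < D \<and>
    (\<forall>v'. (u, v') \<in> parcs G \<and> v \<noteq> v' \<longrightarrow> b u v \<noteq> b u v')"
proof -
  have "\<exists>h. inj_on h {v. (u, v) \<in> parcs G} \<and> h ` {v. (u, v) \<in> parcs G} \<subseteq> {..<D}" for u
  proof -
    have "finite {v. (u, v) \<in> parcs G}" using assms(1) by (rule finite_out_neighbors)
    then show ?thesis
      using card_le_inj[of "{v. (u, v) \<in> parcs G}" "{..<D}"] D[of u] by (auto simp: conj_commute)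
  qed
  then obtain b where "inj_on (b u) {v. (u, v) \<in> parcs G} \<and> b u ` {v. (u, v) \<in> parcs G} \<subseteq> {..<D}" for u
    by metis
  then show ?thesis by (intro exI[of _ b]) (fastforce simp: inj_on_def image_subset_iff)
qed

text \<open>Choosing a colouring for each arc could give the two arcs of an edge unrelated ones, so
  one orientation per edge is chosen and the other arc receives the reversal.\<close>

lemma symmetric_choice:
  assumes ex: "\<And>u v. (u, v) \<in> E \<Longrightarrow> \<exists>f :: nat \<Rightarrow> 'c. Q u v f"
    and rev: "\<And>u v f. Q u v f \<Longrightarrow> Q v u (\<lambda>i. f (n - i))"
    and sym: "\<And>u v. (u, v) \<in> E \<Longrightarrow> (v, u) \<in> E" and irrefl: "\<And>u v. (u, v) \<in> E \<Longrightarrow> u \<noteq> v"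
  shows "\<exists>g. \<forall>u v. (u, v) \<in> E \<longrightarrow> Q u v (g u v) \<and> (\<forall>i\<le>n. g v u (n - i) = g u v i)"
proof -
  obtain F where F: "\<And>u v. (u, v) \<in> E \<Longrightarrow> Q u v (F u v)" using ex by metis
  \<comment> \<open>The set is the same for both arcs, hence so is the chosen orientation; no order
    on the vertices is required.\<close>
  define arc where "arc u v = (SOME e. e \<in> {(u, v), (v, u)})" for u v :: 'a
  have arc_sym: "arc v u = arc u v" for u v by (simp add: arc_def insert_commute)
  have arc_in: "arc u v = (u, v) \<or> arc u v = (v, u)" for u v
    using someI_ex[of "\<lambda>e. e \<in> {(u, v), (v, u)}"] unfolding arc_def by blast
  define g where "g u v = (if arc u v = (u, v) then F u v else (\<lambda>i. F v u (n - i)))" for u v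
  show ?thesis
  proof (intro exI[of _ g] allI impI conjI)
    fix u v assume uv: "(u, v) \<in> E"
    show "Q u v (g u v)" using F[OF uv] rev[OF F[OF sym[OF uv]]] by (simp add: g_def)
    fix i assume "i \<le> n"
    then show "g v u (n - i) = g u v i"
      using arc_in[of u v] arc_sym[of v u] irrefl[OF uv] by (auto simp: g_def)
  qed
qed

lemma fractional_power_coloring:
  assumes G: "pair_graph G" and deg: "\<And>u. card {v. (u, v) \<in> parcs G} \<le> D"
    and D: "3 \<le> D" and n: "2 * m + 2 \<le> n" and K: "2 * m < m div 2 * D + 1 + m mod 2"
  shows "\<exists>c. proper_coloring (fractional_power G m n) c \<and>
    c ` pverts (fractional_power G m n) \<subseteq> {..<m div 2 * D + 1 + m mod 2}"
proof -
  obtain b where b: "\<And>u v. (u, v) \<in> parcs G \<Longrightarrow> b u v < D"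
      "\<And>u v v'. (u, v) \<in> parcs G \<Longrightarrow> (u, v') \<in> parcs G \<Longrightarrow> v \<noteq> v' \<Longrightarrow> b u v \<noteq> b u v'"
    using arc_blocks_exist[OF G deg] by blast
  note arc_sym = pair_graph_arc_sym[OF G] and arc_neq = pair_graph_arc_neq[OF G]
  have "\<exists>g. \<forall>u v. (u, v) \<in> parcs G \<longrightarrow> edge_coloring m D n (b u v) (b v u) (g u v) \<and>
      (\<forall>i\<le>n. g v u (n - i) = g u v i)"
  proof (rule symmetric_choice)
    show "\<exists>f. edge_coloring m D n (b u v) (b v u) f" if "(u, v) \<in> parcs G" for u v
      using edge_coloring_exists[OF b(1)[OF that] b(1)[OF arc_sym[OF that]] D n K] .
  qed (use edge_coloring_rev n arc_sym arc_neq in auto)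
  then obtain g where g: "\<And>u v. (u, v) \<in> parcs G \<Longrightarrow> edge_coloring m D n (b u v) (b v u) (g u v)"
      "\<And>u v i. (u, v) \<in> parcs G \<Longrightarrow> i \<le> n \<Longrightarrow> g v u (n - i) = g u v i"
    by metis
  have ends: "g u v 0 = 0" "g u v n = 0" if "(u, v) \<in> parcs G" for u v
  proof -
    have "end_color m D a c 0 = 0" for a c by (simp add: end_color_def)
    then show "g u v 0 = 0" using g(1)[OF that] unfolding edge_coloring_def by force
    moreover have "g v u 0 = 0"
      using g(1)[OF arc_sym[OF that]] \<open>\<And>a c. end_color m D a c 0 = 0\<close>
      unfolding edge_coloring_def by force
    ultimately show "g u v n = 0" using g(2)[OF arc_sym[OF that], of 0] by simp
  qed
  define rep where "rep x = (\<lambda>(u, v, i). (u, v) \<in> parcs G \<and> i \<le> n \<and> x = sd_vertex n u v i)" for x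
  \<comment> \<open>The default 0 is the colour of a vertex on no edge path. That the chosen
    representation does not matter is shown next.\<close>
  define col where "col x = (if Ex (rep x) then (\<lambda>(u, v, i). g u v i) (SOME t. rep x t) else 0)" for x
  have col: "col (sd_vertex n u v i) = g u v i" if uv: "(u, v) \<in> parcs G" and i: "i \<le> n" for u v i
  proof -
    let ?x = "sd_vertex n u v i"
    have ex: "Ex (rep ?x)" using uv i by (auto simp: rep_def)
    obtain u' v' j where t: "(SOME t. rep ?x t) = (u', v', j)" by (metis prod_cases3)
    then have "rep ?x (u', v', j)" using someI_ex[OF ex] by simp
    then have uv': "(u', v') \<in> parcs G" and j: "j \<le> n" and eq: "?x = sd_vertex n u' v' j"
      by (auto simp: rep_def)
    have "0 < n" using n by simp
    \<comment> \<open>Different representations of an original vertex all give 0 by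
      \<open>ends\<close>; those of an inner vertex differ by reversal, under which \<open>g\<close>
      is invariant.\<close>
    from eq arc_neq[OF uv] arc_neq[OF uv'] i j this have "g u' v' j = g u v i"
      by (cases rule: sd_vertex_eq_cases) (use ends uv uv' g(2)[OF uv i] in auto)
    then show ?thesis using ex t by (simp add: col_def)
  qed
  have less: "col x < m div 2 * D + 1 + m mod 2" for x
  proof (cases "Ex (rep x)")
    case True
    then obtain u v i where "(u, v) \<in> parcs G" "i \<le> n" "x = sd_vertex n u v i"
      by (auto simp: rep_def)
    then show ?thesis using col g(1) unfolding edge_coloring_def by metis
  qed (simp add: col_def)
  have path: "g u v i \<noteq> g u v j"
    if "(u, v) \<in> parcs G" "i \<le> n" "j \<le> n" "i \<le> j + m" "j \<le> i + m" "i \<noteq> j" for u v i j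
  proof -
    have "path_proper m {..n} (g u v)" using g(1)[OF that(1)] by (simp add: edge_coloring_def)
    then show ?thesis
      using that unfolding path_proper_def
      by (cases i j rule: linorder_cases) (metis atMost_iff)+
  qed
  have "proper_coloring (fractional_power G m n) col"
    unfolding proper_coloring_def
  proof clarify
    fix x y assume "(x, y) \<in> parcs (fractional_power G m n)" and same: "col x = col y"
    moreover have "m < n" using n by simp
    ultimately have "sd_near G n m x y" and ne: "x \<noteq> y"
      using fractional_power_arcD[OF G] by blast+
    from this(1)[unfolded sd_near_def] show False
    proof (elim disjE exE conjE)
      fix u v i j
      assume "(u, v) \<in> parcs G" "i \<le> n" "j \<le> n" "i \<le> j + m" "j \<le> i + m"
        "x = sd_vertex n u v i" "y = sd_vertex n u v j"
      then show False using path[of u v i j] col same ne by auto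
    next
      fix u v v' i j
      assume uv: "(u, v) \<in> parcs G" and uv': "(u, v') \<in> parcs G" and vv: "v \<noteq> v'"
        and ij: "i + j \<le> m" and x: "x = sd_vertex n u v i" and y: "y = sd_vertex n u v' j"
      have le: "i \<le> n" "j \<le> n" "i \<le> m" "j \<le> m" using ij n by auto
      obtain c where c: "c < D" "g u v i = end_color m D (b u v) c i"
        using g(1)[OF uv] le unfolding edge_coloring_def by blast
      obtain c' where c': "c' < D" "g u v' j = end_color m D (b u v') c' j"
        using g(1)[OF uv'] le unfolding edge_coloring_def by blast
      have eq: "g u v i = g u v' j" using same x y col uv uv' le by simp
      \<comment> \<open>The vertex at position 0 is \<open>u\<close>, which lies on both paths with
        colour 0; if only one position is 0, the conflict is therefore one inside a single
        path.\<close>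
      consider "i = 0" "j = 0" | "i = 0" "j \<noteq> 0" | "j = 0" "i \<noteq> 0" | "1 \<le> i" "1 \<le> j"
        by linarith
      then show False
      proof cases
        case 1
        then show False using x y ne by (simp add: sd_vertex_0)
      next
        case 2
        then show False using path[OF uv', of 0 j] le eq ends(1)[OF uv] ends(1)[OF uv'] by simp
      next
        case 3
        then show False using path[OF uv, of 0 i] le eq ends(1)[OF uv] ends(1)[OF uv'] by simp
      next
        case 4
        then show False
          using end_color_fork[OF ij 4 b(1)[OF uv] c(1) b(1)[OF uv'] c'(1) b(2)[OF uv uv' vv]]
            eq c(2) c'(2) by simp
      qed
    qed
  qed
  then show ?thesis using less by blast
qed

section \<open>Maximum degree and the final count of colours\<close>

lemma out_degree_with_proj:
  "out_degree (with_proj G) u = card {v. (u, v) \<in> parcs G}"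
proof -
  have "out_arcs (with_proj G) u = Pair u ` {v. (u, v) \<in> parcs G}"
    by (auto simp: out_arcs_def)
  then show ?thesis by (simp add: out_degree_def card_image inj_on_def)
qed

lemma chromatic_eq_clique_fractional_power:
  assumes G: "pair_graph G" and ne: "pverts G \<noteq> {}" and D: "3 \<le> max_degree G"
    and m: "0 < m" and n: "2 * m + 2 \<le> n"
    and K: "2 * m < m div 2 * max_degree G + 1 + m mod 2"
  shows "chromatic_number (fractional_power G m n) = clique_number (fractional_power G m n)"
proof -
  interpret pair_graph G by fact
  interpret H: pair_graph "fractional_power G m n" using G by (rule pair_graph_fractional_power)
  let ?d = "\<lambda>u. card {v. (u, v) \<in> parcs G}"
  have max: "max_degree G = Max (?d ` pverts G)"
    by (simp add: max_degree_def out_degree_with_proj)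
  have "?d u \<le> max_degree G" for u
  proof (cases "u \<in> pverts G")
    case False
    then have "{v. (u, v) \<in> parcs G} = {}" using in_arcsD1 by blast
    then show ?thesis by simp
  qed (simp add: max)
  then obtain c where c: "proper_coloring (fractional_power G m n) c"
      "c ` pverts (fractional_power G m n) \<subseteq> {..<m div 2 * max_degree G + 1 + m mod 2}"
    using fractional_power_coloring[OF G _ D n K] by blast
  have "max_degree G \<in> ?d ` pverts G" unfolding max using ne by (intro Max_in) auto
  then obtain u where u: "?d u = max_degree G" by auto
  then have "{v. (u, v) \<in> parcs G} \<noteq> {}" using D by fastforce
  then obtain C where "clique (fractional_power G m n) C"
      "card C = m div 2 * max_degree G + 1 + m mod 2"
    using fractional_power_clique[OF G refl, of u m n] m n u by auto
  then show ?thesis using c by (intro chromatic_eq_clique_number) auto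
qed

theorem theorem5:
  fixes G :: "'a pair_pre_digraph" and m :: nat
  assumes "pair_graph G"
    and "Digraph_Component.connected (with_proj G)"
    and "m > 1"
  shows "(even m \<and> max_degree G \<ge> 4 \<longrightarrow>
      (\<forall>n::nat. n \<ge> 2 * m + 2 \<longrightarrow>
        chromatic_number (fractional_power G m n) = clique_number (fractional_power G m n)))
    \<and> (odd m \<and> max_degree G \<ge> 5 \<longrightarrow>
      (\<forall>n::nat. n \<ge> 2 * m + 2 \<longrightarrow>
        chromatic_number (fractional_power G m n) = clique_number (fractional_power G m n)))"
proof -
  \<comment> \<open>Connectedness provides a vertex, so the maximum in \<open>max_degree\<close> is
    attained.\<close>
  have ne: "pverts G \<noteq> {}"
    using assms(2) by (auto simp: connected_def strongly_connected_def)
  have "2 * m < m div 2 * max_degree G + 1 + m mod 2" if "even m" "max_degree G \<ge> 4"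
  proof -
    have "m div 2 * 4 \<le> m div 2 * max_degree G" using that by simp
    moreover have "m div 2 * 4 = 2 * m" using that(1) by auto
    ultimately show ?thesis by linarith
  qed
  \<comment> \<open>For \<open>m = 2 * k + 1\<close> and degree 5 this reads
    \<open>4 * k + 2 < 5 * k + 2\<close>, which holds as \<open>m > 1\<close> gives
    \<open>k \<ge> 1\<close>; degree 4 would only give equality.\<close>
  moreover have "2 * m < m div 2 * max_degree G + 1 + m mod 2" if "odd m" "max_degree G \<ge> 5"
  proof -
    have "m div 2 * 5 \<le> m div 2 * max_degree G" using that by simp
    moreover have "2 * m < m div 2 * 5 + 1 + m mod 2" using that(1) assms(3) by presburger
    ultimately show ?thesis by linarith
  qed
  ultimately show ?thesis
    using chromatic_eq_clique_fractional_power[OF assms(1) ne] assms(3) by auto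
qed

end
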